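(* Every selector-free first-order formula over a (co)datatype signature can be effectively transformed into a formula over the corresponding tree signature (same sorts, the constructors as generators, and predicates $\mathrm{fin}_s$) that is equisatisfiable with it, where satisfiability of the former is with respect to structures of (co)datatypes and of the latter with respect to the structure $\mathcal T$ of trees (extended theory of trees).
   Context: A (co)datatype signature: sorts partitioned into datatypes and codatatypes; each (co)datatype has at least one constructor $C:\delta_1\times\cdots\times\delta_n\to\delta$ (with associated selectors); constructor arguments of datatypes are datatypes, of codatatypes are codatatypes; every datatype has a ground constructor term. A structure of (co)datatypes interprets each codatatype as the set of all (finite or infinite) constructor trees of that sort, each datatype as the set of finite constructor trees of that sort, and constructors as tree-building operations (a constructor tree of sort $\delta$ is a rooted ordered possibly infinite tree whose root is labeled by a constructor $C:\delta_1\times\cdots\times\delta_n\to\delta$ and whose children in order are constructor trees of sorts $\delta_1,\dots,\delta_n$). The structure $\mathcal T$ of trees for a many-sorted signature with sorts $S$, generators $f: s_1\times\cdots\times s_n\to s$ and predicates $\mathrm{fin}_s$ ($s\in S$) interprets each sort $s$ as the set of all (finite or infinite) trees of sort $s$ (defined as constructor trees above, labeled by generators), each generator as the corresponding tree-building function, and $\mathrm{fin}_s$ as the set of finite trees of sort $s$. The extended theory of trees is the set of sentences true in $\mathcal T$. *)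

theory Defs
  imports Main "HOL-Library.Nat_Bijection"
begin

section \<open>Many-sorted first-order logic with equality\<close>

text \<open>The partition of the sorts into datatypes and codatatypes is recorded in the sort symbol, so
  that it is part of what an algorithm reading a formula can see.\<close>

datatype sort = is_data: Data nat | is_codata: Codata nat

datatype (funs_trm: 'f) trm = Var sort nat | Fn 'f "'f trm list"

datatype (funs_fm: 'f, preds_fm: 'p) fm =
    Falsum
  | Eq "'f trm" "'f trm"
  | Pred 'p "'f trm list"
  | Neg "('f, 'p) fm"
  | Conj "('f, 'p) fm" "('f, 'p) fm"
  | Disj "('f, 'p) fm" "('f, 'p) fm"
  | Impl "('f, 'p) fm" "('f, 'p) fm"
  | Forall sort nat "('f, 'p) fm"
  | Exists sort nat "('f, 'p) fm"

record ('f, 'p) signature =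
  sorts :: "sort set"
  funs :: "'f set"
  fun_args :: "'f \<Rightarrow> sort list"
  fun_res :: "'f \<Rightarrow> sort"
  preds :: "'p set"
  pred_args :: "'p \<Rightarrow> sort list"

inductive has_sort :: "('f, 'p) signature \<Rightarrow> sort \<Rightarrow> 'f trm \<Rightarrow> bool" for L where
  "s \<in> sorts L \<Longrightarrow> has_sort L s (Var s x)"
| "f \<in> funs L \<Longrightarrow> list_all2 (has_sort L) (fun_args L f) ts \<Longrightarrow> has_sort L (fun_res L f) (Fn f ts)"

primrec formula_over :: "('f, 'p) signature \<Rightarrow> ('f, 'p) fm \<Rightarrow> bool" where
  "formula_over L Falsum \<longleftrightarrow> True"
| "formula_over L (Eq t u) \<longleftrightarrow> (\<exists>s. has_sort L s t \<and> has_sort L s u)"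
| "formula_over L (Pred p ts) \<longleftrightarrow> p \<in> preds L \<and> list_all2 (has_sort L) (pred_args L p) ts"
| "formula_over L (Neg \<phi>) \<longleftrightarrow> formula_over L \<phi>"
| "formula_over L (Conj \<phi> \<psi>) \<longleftrightarrow> formula_over L \<phi> \<and> formula_over L \<psi>"
| "formula_over L (Disj \<phi> \<psi>) \<longleftrightarrow> formula_over L \<phi> \<and> formula_over L \<psi>"
| "formula_over L (Impl \<phi> \<psi>) \<longleftrightarrow> formula_over L \<phi> \<and> formula_over L \<psi>"
| "formula_over L (Forall s x \<phi>) \<longleftrightarrow> s \<in> sorts L \<and> formula_over L \<phi>"
| "formula_over L (Exists s x \<phi>) \<longleftrightarrow> s \<in> sorts L \<and> formula_over L \<phi>"

record ('f, 'p, 'u) struct =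
  universe :: "sort \<Rightarrow> 'u set"
  fun_interp :: "'f \<Rightarrow> 'u list \<Rightarrow> 'u"
  pred_interp :: "'p \<Rightarrow> 'u list \<Rightarrow> bool"

type_synonym 'u assignment = "sort \<Rightarrow> nat \<Rightarrow> 'u"

definition assignment_into ::
  "('f, 'p) signature \<Rightarrow> ('f, 'p, 'u) struct \<Rightarrow> 'u assignment \<Rightarrow> bool" where
  "assignment_into L A v \<longleftrightarrow> (\<forall>s\<in>sorts L. \<forall>x. v s x \<in> universe A s)"

primrec eval_trm :: "('f, 'p, 'u) struct \<Rightarrow> 'u assignment \<Rightarrow> 'f trm \<Rightarrow> 'u" where
  "eval_trm A v (Var s x) = v s x"
| "eval_trm A v (Fn f ts) = fun_interp A f (map (eval_trm A v) ts)"

definition upd :: "'u assignment \<Rightarrow> sort \<Rightarrow> nat \<Rightarrow> 'u \<Rightarrow> 'u assignment" where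
  "upd v s x a = v(s := (v s)(x := a))"

primrec sat :: "('f, 'p, 'u) struct \<Rightarrow> 'u assignment \<Rightarrow> ('f, 'p) fm \<Rightarrow> bool" where
  "sat A v Falsum \<longleftrightarrow> False"
| "sat A v (Eq t u) \<longleftrightarrow> eval_trm A v t = eval_trm A v u"
| "sat A v (Pred p ts) \<longleftrightarrow> pred_interp A p (map (eval_trm A v) ts)"
| "sat A v (Neg \<phi>) \<longleftrightarrow> \<not> sat A v \<phi>"
| "sat A v (Conj \<phi> \<psi>) \<longleftrightarrow> sat A v \<phi> \<and> sat A v \<psi>"
| "sat A v (Disj \<phi> \<psi>) \<longleftrightarrow> sat A v \<phi> \<or> sat A v \<psi>"
| "sat A v (Impl \<phi> \<psi>) \<longleftrightarrow> (sat A v \<phi> \<longrightarrow> sat A v \<psi>)"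
| "sat A v (Forall s x \<phi>) \<longleftrightarrow> (\<forall>a\<in>universe A s. sat A (upd v s x a) \<phi>)"
| "sat A v (Exists s x \<phi>) \<longleftrightarrow> (\<exists>a\<in>universe A s. sat A (upd v s x a) \<phi>)"

definition satisfiable_in ::
  "('f, 'p) signature \<Rightarrow> ('f, 'p, 'u) struct \<Rightarrow> ('f, 'p) fm \<Rightarrow> bool" where
  "satisfiable_in L A \<phi> \<longleftrightarrow> (\<exists>v. assignment_into L A v \<and> sat A v \<phi>)"


section \<open>(Co)datatype signatures and tree signatures\<close>

record ctor_sig =
  csorts :: "sort set"
  ctors :: "nat set"
  ctor_args :: "nat \<Rightarrow> sort list"
  ctor_res :: "nat \<Rightarrow> sort"

text \<open>\<^term>\<open>Sel c i\<close> is the selector of the \<open>i\<close>-th argument (counted from 0) of the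
  constructor \<open>c\<close>.\<close>

datatype cd_fun = Ctor nat | Sel nat nat

text \<open>The predicate symbol type is \<^typ>\<open>unit\<close> only because HOL types are nonempty;
  there are no predicate symbols besides equality.\<close>

definition cd_language :: "ctor_sig \<Rightarrow> (cd_fun, unit) signature" where
  "cd_language \<Sigma> =
     \<lparr> sorts = csorts \<Sigma>,
       funs = Ctor ` ctors \<Sigma> \<union> {Sel c i | c i. c \<in> ctors \<Sigma> \<and> i < length (ctor_args \<Sigma> c)},
       fun_args = (\<lambda>f. case f of Ctor c \<Rightarrow> ctor_args \<Sigma> c | Sel c i \<Rightarrow> [ctor_res \<Sigma> c]),
       fun_res = (\<lambda>f. case f of Ctor c \<Rightarrow> ctor_res \<Sigma> c | Sel c i \<Rightarrow> ctor_args \<Sigma> c ! i),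
       preds = {},
       pred_args = (\<lambda>_. []) \<rparr>"

text \<open>The predicate symbol \<open>s\<close> of the tree language stands for \<open>fin\<^sub>s\<close>.\<close>

definition tree_language :: "ctor_sig \<Rightarrow> (nat, sort) signature" where
  "tree_language \<Sigma> =
     \<lparr> sorts = csorts \<Sigma>,
       funs = ctors \<Sigma>,
       fun_args = ctor_args \<Sigma>,
       fun_res = ctor_res \<Sigma>,
       preds = csorts \<Sigma>,
       pred_args = (\<lambda>s. [s]) \<rparr>"

definition selector_free :: "(cd_fun, 'p) fm \<Rightarrow> bool" where
  "selector_free \<phi> \<longleftrightarrow> (\<forall>c i. Sel c i \<notin> funs_fm \<phi>)"

primrec ground :: "'f trm \<Rightarrow> bool" where
  "ground (Var s x) \<longleftrightarrow> False"
| "ground (Fn f ts) \<longleftrightarrow> list_all ground ts"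

definition ground_ctor_term :: "ctor_sig \<Rightarrow> sort \<Rightarrow> cd_fun trm \<Rightarrow> bool" where
  "ground_ctor_term \<Sigma> s t \<longleftrightarrow>
     has_sort (cd_language \<Sigma>) s t \<and> ground t \<and> funs_trm t \<subseteq> range Ctor"

definition cd_signature :: "ctor_sig \<Rightarrow> bool" where
  "cd_signature \<Sigma> \<longleftrightarrow>
     (\<forall>c\<in>ctors \<Sigma>. ctor_res \<Sigma> c \<in> csorts \<Sigma> \<and> set (ctor_args \<Sigma> c) \<subseteq> csorts \<Sigma>) \<and>
     (\<forall>s\<in>csorts \<Sigma>. \<exists>c\<in>ctors \<Sigma>. ctor_res \<Sigma> c = s) \<and>
     (\<forall>c\<in>ctors \<Sigma>. is_data (ctor_res \<Sigma> c) \<longrightarrow> (\<forall>s\<in>set (ctor_args \<Sigma> c). is_data s)) \<and>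
     (\<forall>c\<in>ctors \<Sigma>. is_codata (ctor_res \<Sigma> c) \<longrightarrow> (\<forall>s\<in>set (ctor_args \<Sigma> c). is_codata s)) \<and>
     (\<forall>s\<in>csorts \<Sigma>. is_data s \<longrightarrow> (\<exists>t. ground_ctor_term \<Sigma> s t))"


section \<open>Trees and the intended structures\<close>

codatatype ctree = Node (root: nat) (children: "ctree list")

coinductive tree_of_sort :: "ctor_sig \<Rightarrow> sort \<Rightarrow> ctree \<Rightarrow> bool" for \<Sigma> where
  "c \<in> ctors \<Sigma> \<Longrightarrow> list_all2 (tree_of_sort \<Sigma>) (ctor_args \<Sigma> c) ts \<Longrightarrow>
     tree_of_sort \<Sigma> (ctor_res \<Sigma> c) (Node c ts)"

text \<open>The nodes of a tree, given as paths from the root.\<close>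

inductive is_node :: "ctree \<Rightarrow> nat list \<Rightarrow> bool" where
  "is_node t []"
| "i < length ts \<Longrightarrow> is_node (ts ! i) p \<Longrightarrow> is_node (Node c ts) (i # p)"

definition finite_tree :: "ctree \<Rightarrow> bool" where
  "finite_tree t \<longleftrightarrow> finite {p. is_node t p}"

text \<open>Structures of (co)datatypes differ only in the values of selectors on trees built by a
  different constructor, which are arbitrary elements of the right sort.\<close>

definition cd_structure :: "ctor_sig \<Rightarrow> (cd_fun, unit, ctree) struct \<Rightarrow> bool" where
  "cd_structure \<Sigma> A \<longleftrightarrow>
     (\<forall>s\<in>csorts \<Sigma>. is_codata s \<longrightarrow> universe A s = {t. tree_of_sort \<Sigma> s t}) \<and>
     (\<forall>s\<in>csorts \<Sigma>. is_data s \<longrightarrow> universe A s = {t. tree_of_sort \<Sigma> s t \<and> finite_tree t}) \<and>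
     (\<forall>c\<in>ctors \<Sigma>. \<forall>ts. list_all2 (\<lambda>s t. t \<in> universe A s) (ctor_args \<Sigma> c) ts \<longrightarrow>
        fun_interp A (Ctor c) ts = Node c ts) \<and>
     (\<forall>c\<in>ctors \<Sigma>. \<forall>i<length (ctor_args \<Sigma> c). \<forall>t\<in>universe A (ctor_res \<Sigma> c).
        fun_interp A (Sel c i) [t] \<in> universe A (ctor_args \<Sigma> c ! i) \<and>
        (root t = c \<longrightarrow> fun_interp A (Sel c i) [t] = children t ! i))"

definition tree_structure :: "ctor_sig \<Rightarrow> (nat, sort, ctree) struct" where
  "tree_structure \<Sigma> =
     \<lparr> universe = (\<lambda>s. {t. tree_of_sort \<Sigma> s t}),
       fun_interp = Node,
       pred_interp = (\<lambda>s ts. \<exists>t. ts = [t] \<and> tree_of_sort \<Sigma> s t \<and> finite_tree t) \<rparr>"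

definition cd_satisfiable :: "ctor_sig \<Rightarrow> (cd_fun, unit) fm \<Rightarrow> bool" where
  "cd_satisfiable \<Sigma> \<phi> \<longleftrightarrow> (\<exists>A. cd_structure \<Sigma> A \<and> satisfiable_in (cd_language \<Sigma>) A \<phi>)"

definition tree_satisfiable :: "ctor_sig \<Rightarrow> (nat, sort) fm \<Rightarrow> bool" where
  "tree_satisfiable \<Sigma> \<psi> \<longleftrightarrow> satisfiable_in (tree_language \<Sigma>) (tree_structure \<Sigma>) \<psi>"


section \<open>Effectiveness\<close>

text \<open>Kleene's partial recursive functions; \<^term>\<open>Rec f g\<close> and \<^term>\<open>Mu f\<close>
  recurse on, respectively search over, the first argument.\<close>

datatype recf = Zero | Succ | Proj nat | Comp recf "recf list" | Rec recf recf | Mu recf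

inductive recf_eval :: "recf \<Rightarrow> nat list \<Rightarrow> nat \<Rightarrow> bool" where
  "recf_eval Zero xs 0"
| "recf_eval Succ [x] (Suc x)"
| "i < length xs \<Longrightarrow> recf_eval (Proj i) xs (xs ! i)"
| "list_all2 (\<lambda>g y. recf_eval g xs y) gs ys \<Longrightarrow> recf_eval f ys z \<Longrightarrow> recf_eval (Comp f gs) xs z"
| "recf_eval f xs y \<Longrightarrow> recf_eval (Rec f g) (0 # xs) y"
| "recf_eval (Rec f g) (n # xs) y \<Longrightarrow> recf_eval g (n # y # xs) z \<Longrightarrow>
     recf_eval (Rec f g) (Suc n # xs) z"
| "recf_eval f (n # xs) 0 \<Longrightarrow> (\<forall>m<n. \<exists>k. recf_eval f (m # xs) (Suc k)) \<Longrightarrow>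
     recf_eval (Mu f) xs n"

definition effective_on :: "'a set \<Rightarrow> ('a \<Rightarrow> nat) \<Rightarrow> ('b \<Rightarrow> nat) \<Rightarrow> ('a \<Rightarrow> 'b) \<Rightarrow> bool" where
  "effective_on D code code' T \<longleftrightarrow> (\<exists>r. \<forall>x\<in>D. recf_eval r [code x] (code' (T x)))"

primrec sort_code :: "sort \<Rightarrow> nat" where
  "sort_code (Data n) = 2 * n"
| "sort_code (Codata n) = 2 * n + 1"

primrec trm_code :: "('f \<Rightarrow> nat) \<Rightarrow> 'f trm \<Rightarrow> nat" where
  "trm_code cf (Var s x) = prod_encode (0, prod_encode (sort_code s, x))"
| "trm_code cf (Fn f ts) = prod_encode (1, prod_encode (cf f, list_encode (map (trm_code cf) ts)))"

primrec fm_code :: "('f \<Rightarrow> nat) \<Rightarrow> ('p \<Rightarrow> nat) \<Rightarrow> ('f, 'p) fm \<Rightarrow> nat" where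
  "fm_code cf cp Falsum = prod_encode (0, 0)"
| "fm_code cf cp (Eq t u) = prod_encode (1, prod_encode (trm_code cf t, trm_code cf u))"
| "fm_code cf cp (Pred p ts) =
     prod_encode (2, prod_encode (cp p, list_encode (map (trm_code cf) ts)))"
| "fm_code cf cp (Neg \<phi>) = prod_encode (3, fm_code cf cp \<phi>)"
| "fm_code cf cp (Conj \<phi> \<psi>) = prod_encode (4, prod_encode (fm_code cf cp \<phi>, fm_code cf cp \<psi>))"
| "fm_code cf cp (Disj \<phi> \<psi>) = prod_encode (5, prod_encode (fm_code cf cp \<phi>, fm_code cf cp \<psi>))"
| "fm_code cf cp (Impl \<phi> \<psi>) = prod_encode (6, prod_encode (fm_code cf cp \<phi>, fm_code cf cp \<psi>))"
| "fm_code cf cp (Forall s x \<phi>) =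
     prod_encode (7, prod_encode (prod_encode (sort_code s, x), fm_code cf cp \<phi>))"
| "fm_code cf cp (Exists s x \<phi>) =
     prod_encode (8, prod_encode (prod_encode (sort_code s, x), fm_code cf cp \<phi>))"

primrec cd_fun_code :: "cd_fun \<Rightarrow> nat" where
  "cd_fun_code (Ctor c) = 2 * c"
| "cd_fun_code (Sel c i) = 2 * prod_encode (c, i) + 1"

definition cd_fm_code :: "(cd_fun, unit) fm \<Rightarrow> nat" where
  "cd_fm_code = fm_code cd_fun_code (\<lambda>_. 0)"

text \<open>A generator is the same symbol as the constructor and gets the same code.\<close>

definition tree_fm_code :: "(nat, sort) fm \<Rightarrow> nat" where
  "tree_fm_code = fm_code (\<lambda>c. cd_fun_code (Ctor c)) sort_code"

lemma recf_eval_det: "recf_eval r xs y \<Longrightarrow> recf_eval r xs z \<Longrightarrow> y = z"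
proof (induction arbitrary: z rule: recf_eval.induct)
  case (4 xs gs ys f w)
  from 4(4) obtain ys' where
    ys': "list_all2 (\<lambda>g y. recf_eval g xs y) gs ys'" "recf_eval f ys' z"
    by (cases rule: recf_eval.cases) auto
  have "ys = ys'"
    using 4(1) ys'(1)
    by (auto intro!: nth_equalityI simp: list_all2_conv_all_nth)
  then show ?case using "4.IH" ys'(2) by simp
next
  case (6 f g n xs y w)
  from 6(5) obtain y' where "recf_eval (Rec f g) (n # xs) y'" "recf_eval g (n # y' # xs) z"
    by (cases rule: recf_eval.cases) auto
  then show ?case using 6 by blast
next
  case (7 f n xs)
  from 7(4) have z: "recf_eval f (z # xs) 0" "\<forall>m<z. \<exists>k. recf_eval f (m # xs) (Suc k)"
    by (auto elim: recf_eval.cases)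
  show ?case
  proof (rule linorder_cases[of n z])
    assume "n < z"
    with z(2) obtain k where "recf_eval f (n # xs) (Suc k)" by blast
    with 7(2) show ?thesis by fastforce
  next
    assume "z < n"
    with 7(3) z(1) show ?thesis by fastforce
  qed
next
  case 1 then show ?case by (cases rule: recf_eval.cases) auto
next
  case 2 then show ?case by (cases rule: recf_eval.cases) auto
next
  case 3 from 3(2) show ?case by (cases rule: recf_eval.cases) auto
next
  case (5 f xs y g)
  from 5(3) have "recf_eval f xs z" by (cases rule: recf_eval.cases) auto
  then show ?case by (rule 5(2))
qed

lemma sort_code_inj: "sort_code s = sort_code s' \<longleftrightarrow> s = s'"
  by (cases s; cases s') (auto, presburger+)

lemma trm_code_inj:
  assumes "inj cf"
  shows "trm_code cf t = trm_code cf u \<longleftrightarrow> t = u"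
proof (induction t arbitrary: u)
  case (Var s x)
  then show ?case by (cases u) (auto simp: sort_code_inj)
next
  case (Fn f ts)
  show ?case
  proof (cases u)
    case u: (Fn g us)
    have "map (trm_code cf) ts = map (trm_code cf) us \<Longrightarrow> ts = us"
      using Fn by (metis list.inj_map_strong)
    then show ?thesis
      using u by (auto simp: list_encode_eq inj_eq[OF assms])
  qed auto
qed

lemma fm_code_inj:
  assumes "inj cf" "inj cp"
  shows "inj (fm_code cf cp)"
proof -
  have maps: "map (trm_code cf) ts = map (trm_code cf) us \<longleftrightarrow> ts = us" for ts us
    using trm_code_inj[OF assms(1)] by (metis list.inj_map_strong)
  have "fm_code cf cp \<phi> = fm_code cf cp \<psi> \<Longrightarrow> \<phi> = \<psi>" for \<phi> \<psi>
  proof (induction \<phi> arbitrary: \<psi>)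
    case Falsum then show ?case by (cases \<psi>) auto
  next
    case Eq then show ?case by (cases \<psi>) (auto simp: trm_code_inj[OF assms(1)])
  next
    case Pred then show ?case by (cases \<psi>) (auto simp: maps list_encode_eq inj_eq[OF assms(2)])
  next
    case Neg then show ?case by (cases \<psi>) auto
  next
    case Conj then show ?case by (cases \<psi>) auto
  next
    case Disj then show ?case by (cases \<psi>) auto
  next
    case Impl then show ?case by (cases \<psi>) auto
  next
    case Forall then show ?case by (cases \<psi>) (auto simp: sort_code_inj)
  next
    case Exists then show ?case by (cases \<psi>) (auto simp: sort_code_inj)
  qed
  then show ?thesis by (rule injI)
qed

lemma cd_fm_code_inj: "inj cd_fm_code"
proof -
  have "f = g" if "cd_fun_code f = cd_fun_code g" for f g
    using that by (cases f; cases g) (auto, presburger+)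
  then show ?thesis
    unfolding cd_fm_code_def by (intro fm_code_inj) (auto intro: injI)
qed

lemma tree_fm_code_inj: "inj tree_fm_code"
  unfolding tree_fm_code_def
  by (intro fm_code_inj) (auto intro: injI simp: sort_code_inj)

end

theory Submission
  imports Defs
begin

text \<open>
  Quantifiers over a datatype \<open>s\<close> are relativized to \<open>fin\<^sub>s\<close>, and \<open>fin\<^sub>s(x)\<close> is conjoined for
  every variable \<open>x\<close> of a datatype that occurs in the formula; quantifiers over codatatypes are
  unchanged, as codatatypes already contain all trees. Since constructors of datatypes only take
  datatypes as arguments, terms have the same value in a structure of (co)datatypes and in the
  structure of trees. The translation does not look at the signature, because sort symbols record
  whether they are datatypes. On codes it leaves terms unchanged and is otherwise a
  course-of-values recursion, which is reduced to primitive recursion by carrying along the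
  iterated pairing of all earlier values.
\<close>

section \<open>Total recursive functions\<close>

text \<open>Functions act on whole argument lists of length \<open>k\<close>, so that
  \<open>intro rec_intros\<close> follows the syntax of an expression and assembles a program for
  it.\<close>

definition rec_fun :: "nat \<Rightarrow> (nat list \<Rightarrow> nat) \<Rightarrow> bool" where
  "rec_fun k f \<longleftrightarrow> (\<exists>r. \<forall>xs. length xs = k \<longrightarrow> recf_eval r xs (f xs))"

named_theorems rec_intros

lemma rec_fun_nth [rec_intros]: "i < k \<Longrightarrow> rec_fun k (\<lambda>xs. xs ! i)"
  unfolding rec_fun_def by (metis recf_eval.intros(3))

lemma rec_fun_Suc [rec_intros]:
  assumes "rec_fun k a"
  shows "rec_fun k (\<lambda>xs. Suc (a xs))"
proof -
  from assms obtain r where r: "\<And>xs. length xs = k \<Longrightarrow> recf_eval r xs (a xs)"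
    unfolding rec_fun_def by blast
  have "recf_eval (Comp Succ [r]) xs (Suc (a xs))" if "length xs = k" for xs
    using r[OF that] by (auto intro!: recf_eval.intros(4)[where ys = "[a xs]"] recf_eval.intros(2))
  then show ?thesis unfolding rec_fun_def by blast
qed

lemma rec_fun_const [rec_intros]: "rec_fun k (\<lambda>_. n)"
proof (induction n)
  case 0
  show ?case unfolding rec_fun_def by (blast intro: recf_eval.intros(1))
qed (rule rec_fun_Suc)

text \<open>Weakening: in the body of a recursion the old arguments sit behind the counter and the
  previous value.\<close>

lemma rec_fun_drop2 [rec_intros]:
  assumes "rec_fun k a"
  shows "rec_fun (Suc (Suc k)) (\<lambda>xs. a (drop 2 xs))"
proof -
  from assms obtain r where r: "\<And>xs. length xs = k \<Longrightarrow> recf_eval r xs (a xs)"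
    unfolding rec_fun_def by blast
  have "recf_eval (Comp r (map (\<lambda>i. Proj (Suc (Suc i))) [0..<k])) xs (a (drop 2 xs))"
    if "length xs = Suc (Suc k)" for xs
  proof (rule recf_eval.intros(4))
    show "list_all2 (\<lambda>g y. recf_eval g xs y) (map (\<lambda>i. Proj (Suc (Suc i))) [0..<k]) (drop 2 xs)"
      using that recf_eval.intros(3)[of _ xs] by (auto simp: list_all2_conv_all_nth)
  qed (use that in \<open>auto intro: r\<close>)
  then show ?thesis unfolding rec_fun_def by blast
qed

text \<open>\<open>Rec\<close> recurses on its first argument, so \<open>Comp\<close> puts
  \<open>c xs\<close> in front of projections that copy the parameters.\<close>

lemma rec_fun_rec_nat [rec_intros]:
  assumes "rec_fun k c" "rec_fun k b"
    and "rec_fun (Suc (Suc k)) (\<lambda>ys. s (ys ! 0) (ys ! 1) (drop 2 ys))"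
  shows "rec_fun k (\<lambda>xs. rec_nat (b xs) (\<lambda>n y. s n y xs) (c xs))"
proof -
  from assms(1) obtain rc where rc: "\<And>xs. length xs = k \<Longrightarrow> recf_eval rc xs (c xs)"
    unfolding rec_fun_def by blast
  from assms(2) obtain rb where rb: "\<And>xs. length xs = k \<Longrightarrow> recf_eval rb xs (b xs)"
    unfolding rec_fun_def by blast
  from assms(3) obtain rs where rs: "\<And>ys. length ys = Suc (Suc k) \<Longrightarrow>
      recf_eval rs ys (s (ys ! 0) (ys ! 1) (drop 2 ys))"
    unfolding rec_fun_def by blast
  have rec: "recf_eval (Rec rb rs) (n # xs) (rec_nat (b xs) (\<lambda>n y. s n y xs) n)"
    if "length xs = k" for n xs
  proof (induction n)
    case 0
    show ?case using rb[OF that] by (auto intro: recf_eval.intros(5))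
  next
    case (Suc n)
    let ?y = "rec_nat (b xs) (\<lambda>n y. s n y xs) n"
    show ?case using recf_eval.intros(6)[OF Suc] rs[of "n # ?y # xs"] that by auto
  qed
  have "recf_eval (Comp (Rec rb rs) (rc # map Proj [0..<k])) xs
      (rec_nat (b xs) (\<lambda>n y. s n y xs) (c xs))" if "length xs = k" for xs
  proof (rule recf_eval.intros(4))
    show "list_all2 (\<lambda>g y. recf_eval g xs y) (rc # map Proj [0..<k]) (c xs # xs)"
      using that rc[OF that] recf_eval.intros(3)[of _ xs]
      by (auto simp: list_all2_conv_all_nth nth_Cons split: nat.split)
  qed (rule rec[OF that])
  then show ?thesis unfolding rec_fun_def by blast
qed

lemma rec_fun_eq: "rec_fun k f \<Longrightarrow> (\<And>xs. g xs = f xs) \<Longrightarrow> rec_fun k g"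
  by presburger

section \<open>Arithmetic and conditionals\<close>

lemma rec_fun_add [rec_intros]:
  assumes "rec_fun k a" "rec_fun k b"
  shows "rec_fun k (\<lambda>xs. a xs + b xs)"
proof (rule rec_fun_eq)
  show "rec_fun k (\<lambda>xs. rec_nat (a xs) (\<lambda>n y. Suc y) (b xs))"
    by (intro rec_intros assms) simp
  show "a xs + b xs = rec_nat (a xs) (\<lambda>n y. Suc y) (b xs)" for xs
    by (induction "b xs" arbitrary: b) (simp, metis add_Suc_right old.nat.simps(7))
qed

lemma rec_fun_pred [rec_intros]:
  assumes "rec_fun k a"
  shows "rec_fun k (\<lambda>xs. a xs - 1)"
proof (rule rec_fun_eq)
  show "rec_fun k (\<lambda>xs. rec_nat 0 (\<lambda>n y. n) (a xs))"
    by (intro rec_intros assms) simp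
  show "a xs - 1 = rec_nat 0 (\<lambda>n y. n) (a xs)" for xs
    by (cases "a xs") auto
qed

lemma rec_fun_diff [rec_intros]:
  assumes "rec_fun k a" "rec_fun k b"
  shows "rec_fun k (\<lambda>xs. a xs - b xs)"
proof (rule rec_fun_eq)
  show "rec_fun k (\<lambda>xs. rec_nat (a xs) (\<lambda>n y. y - 1) (b xs))"
    by (intro rec_intros assms) simp
  have "m - n = rec_nat m (\<lambda>n y. y - 1) n" for m n :: nat
    by (induction n) auto
  then show "a xs - b xs = rec_nat (a xs) (\<lambda>n y. y - 1) (b xs)" for xs .
qed

lemma rec_fun_if_eq [rec_intros]:
  assumes "rec_fun k a" "rec_fun k b" "rec_fun k c" "rec_fun k d"
  shows "rec_fun k (\<lambda>xs. if a xs = b xs then c xs else d xs)"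
proof (rule rec_fun_eq)
  \<comment> \<open>The sum of the two truncated differences is \<open>0\<close> exactly when the
    numbers agree; at a positive count the constant step returns \<open>d xs\<close>.\<close>
  show "rec_fun k (\<lambda>xs. rec_nat (c xs) (\<lambda>n y. d xs) ((a xs - b xs) + (b xs - a xs)))"
    by (intro rec_intros assms)
  show "(if a xs = b xs then c xs else d xs) =
      rec_nat (c xs) (\<lambda>n y. d xs) ((a xs - b xs) + (b xs - a xs))" for xs
    by (cases "(a xs - b xs) + (b xs - a xs)") auto
qed

lemma rec_fun_if_even [rec_intros]:
  assumes "rec_fun k a" "rec_fun k c" "rec_fun k d"
  shows "rec_fun k (\<lambda>xs. if even (a xs) then c xs else d xs)"
proof (rule rec_fun_eq)
  \<comment> \<open>Iterating \<open>1 - y\<close> from \<open>0\<close> alternates between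
    \<open>0\<close> and \<open>1\<close>, which computes the parity.\<close>
  show "rec_fun k (\<lambda>xs. if rec_nat 0 (\<lambda>n y. 1 - y) (a xs) = (0::nat) then c xs else d xs)"
    by (intro rec_intros assms) simp
  have "rec_nat 0 (\<lambda>n y. 1 - y) n = (if even n then 0 else 1 :: nat)" for n
    by (induction n) auto
  then show "(if even (a xs) then c xs else d xs) =
      (if rec_nat 0 (\<lambda>n y. 1 - y) (a xs) = (0::nat) then c xs else d xs)" for xs
    by simp
qed

lemma rec_fun_triangle [rec_intros]:
  assumes "rec_fun k a"
  shows "rec_fun k (\<lambda>xs. triangle (a xs))"
proof (rule rec_fun_eq)
  show "rec_fun k (\<lambda>xs. rec_nat 0 (\<lambda>n y. y + Suc n) (a xs))"
    by (intro rec_intros assms) simp_all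
  have "triangle n = rec_nat 0 (\<lambda>n y. y + Suc n) n" for n
    by (induction n) auto
  then show "triangle (a xs) = rec_nat 0 (\<lambda>n y. y + Suc n) (a xs)" for xs .
qed

section \<open>Pairing and its inverse\<close>

lemma rec_fun_prod_encode [rec_intros]:
  "rec_fun k a \<Longrightarrow> rec_fun k b \<Longrightarrow> rec_fun k (\<lambda>xs. prod_encode (a xs, b xs))"
  by (simp add: prod_encode_def rec_intros)

text \<open>The decoding of pairs is not primitive recursive as the library defines it. The index of the
  diagonal of a pair is, because it grows by one exactly at the triangular numbers, and it determines
  both components.\<close>

definition diagonal :: "nat \<Rightarrow> nat" where
  "diagonal = rec_nat 0 (\<lambda>n y. if triangle (Suc y) - Suc n = 0 then Suc y else y)"

text \<open>The truncated difference in \<open>diagonal\<close> vanishes exactly when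
  \<open>Suc n\<close> has reached the next triangular number.\<close>

lemma diagonal_bounds: "triangle (diagonal n) \<le> n \<and> n < triangle (Suc (diagonal n))"
proof (induction n)
  case (Suc n)
  have "diagonal (Suc n) =
      (if triangle (Suc (diagonal n)) - Suc n = 0 then Suc (diagonal n) else diagonal n)"
    by (simp add: diagonal_def)
  with Suc show ?case by auto
qed (simp add: diagonal_def)

text \<open>The code is \<open>triangle (a + b) + a\<close>, hence lies between the triangular
  numbers of \<open>a + b\<close> and its successor; monotonicity of \<open>triangle\<close> leaves
  only one such index.\<close>

lemma diagonal_prod_encode: "diagonal (prod_encode (a, b)) = a + b"
proof -
  have tri: "triangle m \<le> triangle n" if "m \<le> n" for m n
    using that by (induction rule: dec_induct) auto
  have "triangle (a + b) \<le> prod_encode (a, b)" "prod_encode (a, b) < triangle (Suc (a + b))"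
    by (auto simp: prod_encode_def)
  with diagonal_bounds[of "prod_encode (a, b)"]
    tri[of "Suc (diagonal (prod_encode (a, b)))" "a + b"]
    tri[of "Suc (a + b)" "diagonal (prod_encode (a, b))"]
  show ?thesis by linarith
qed

definition pfst :: "nat \<Rightarrow> nat" where "pfst n = fst (prod_decode n)"

definition psnd :: "nat \<Rightarrow> nat" where "psnd n = snd (prod_decode n)"

lemma pfst_prod_encode [simp]: "pfst (prod_encode (a, b)) = a"
  and psnd_prod_encode [simp]: "psnd (prod_encode (a, b)) = b"
  by (simp_all add: pfst_def psnd_def)

text \<open>Together with \<open>psnd_eq\<close>, this trades decoding for operations already known
  to be recursive.\<close>

lemma pfst_eq: "pfst n = n - triangle (diagonal n)"
proof -
  obtain a b where "n = prod_encode (a, b)" by (metis prod_decode_inverse surj_pair)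
  then show ?thesis by (simp add: diagonal_prod_encode) (simp add: prod_encode_def)
qed

lemma psnd_eq: "psnd n = diagonal n - pfst n"
proof -
  obtain a b where "n = prod_encode (a, b)" by (metis prod_decode_inverse surj_pair)
  then show ?thesis by (simp add: diagonal_prod_encode)
qed

lemma rec_fun_diagonal [rec_intros]:
  assumes "rec_fun k a"
  shows "rec_fun k (\<lambda>xs. diagonal (a xs))"
  unfolding diagonal_def by (intro rec_intros assms) simp_all

lemma rec_fun_pfst [rec_intros]: "rec_fun k a \<Longrightarrow> rec_fun k (\<lambda>xs. pfst (a xs))"
  unfolding pfst_eq by (intro rec_intros)

lemma rec_fun_psnd [rec_intros]: "rec_fun k a \<Longrightarrow> rec_fun k (\<lambda>xs. psnd (a xs))"
  unfolding psnd_eq by (intro rec_intros)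


section \<open>Course-of-values recursion\<close>

text \<open>The newest value is outermost: the values at \<open>n - 1\<close>, ..., \<open>0\<close>
  are paired in this order, ending in \<open>0\<close>.\<close>

definition history :: "(nat \<Rightarrow> nat \<Rightarrow> nat) \<Rightarrow> nat \<Rightarrow> nat" where
  "history g = rec_nat 0 (\<lambda>n h. prod_encode (g n h, h))"

text \<open>In the history up to \<open>n\<close>, the entry for \<open>m < n\<close> lies below
  \<open>n - Suc m\<close> newer ones.\<close>

definition lookup :: "nat \<Rightarrow> nat \<Rightarrow> nat \<Rightarrow> nat" where
  "lookup n h m = pfst (rec_nat h (\<lambda>_. psnd) (n - Suc m))"

definition cov :: "(nat \<Rightarrow> nat \<Rightarrow> nat) \<Rightarrow> nat \<Rightarrow> nat" where
  "cov g n = g n (history g n)"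

lemma lookup_history:
  assumes "m < n"
  shows "lookup n (history g n) m = cov g m"
proof -
  \<comment> \<open>\<open>rec_nat\<close> applies the last \<open>psnd\<close> outermost, while the
    induction below has to strip the newest entry first.\<close>
  have shift: "rec_nat (psnd h) (\<lambda>_. psnd) i = psnd (rec_nat h (\<lambda>_. psnd) i)" for h i
    by (induction i) auto
  have "rec_nat (history g (Suc m + i)) (\<lambda>_. psnd) i = history g (Suc m)" for i
  proof (induction i)
    case (Suc i)
    have "psnd (history g (Suc m + Suc i)) = history g (Suc m + i)"
      by (simp add: history_def)
    with Suc shift[of "history g (Suc m + Suc i)" i] show ?case by simp
  qed simp
  from this[of "n - Suc m"] assms show ?thesis
    by (simp add: lookup_def cov_def) (simp add: history_def)
qed

lemma rec_fun_lookup [rec_intros]: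
  assumes "rec_fun k a" "rec_fun k b" "rec_fun k c"
  shows "rec_fun k (\<lambda>xs. lookup (a xs) (b xs) (c xs))"
  unfolding lookup_def by (intro rec_intros assms) simp

text \<open>The step is needed at two arities, inside the recursion and once more at the end, hence
  the hypothesis for all \<open>k\<close>.\<close>

lemma rec_fun_cov:
  assumes g: "\<And>k a b. rec_fun k a \<Longrightarrow> rec_fun k b \<Longrightarrow> rec_fun k (\<lambda>xs. g (a xs) (b xs))"
    and "rec_fun k a"
  shows "rec_fun k (\<lambda>xs. cov g (a xs))"
  unfolding cov_def history_def by (intro g rec_intros assms) simp_all


section \<open>The translation\<close>

text \<open>\<open>Neg Falsum\<close> stands for truth and ends the conjunction over the arguments,
  as the empty list ends their code.\<close>

primrec fin_trm :: "'f trm \<Rightarrow> (nat, sort) fm" where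
  "fin_trm (Var s x) = (if is_data s then Pred s [Var s x] else Neg Falsum)"
| "fin_trm (Fn f ts) = foldr Conj (map fin_trm ts) (Neg Falsum)"

text \<open>Bound variables are constrained too. This is harmless: the value that an assignment gives to
  such a variable does not matter, and every datatype has a finite tree.\<close>

primrec fin_fm :: "('f, 'p) fm \<Rightarrow> (nat, sort) fm" where
  "fin_fm Falsum = Neg Falsum"
| "fin_fm (Eq t u) = Conj (fin_trm t) (fin_trm u)"
| "fin_fm (Pred p ts) = Neg Falsum"
| "fin_fm (Neg \<phi>) = fin_fm \<phi>"
| "fin_fm (Conj \<phi> \<psi>) = Conj (fin_fm \<phi>) (fin_fm \<psi>)"
| "fin_fm (Disj \<phi> \<psi>) = Conj (fin_fm \<phi>) (fin_fm \<psi>)"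
| "fin_fm (Impl \<phi> \<psi>) = Conj (fin_fm \<phi>) (fin_fm \<psi>)"
| "fin_fm (Forall s x \<phi>) = fin_fm \<phi>"
| "fin_fm (Exists s x \<phi>) = fin_fm \<phi>"

primrec ctor_of :: "cd_fun \<Rightarrow> nat" where
  "ctor_of (Ctor c) = c"
| "ctor_of (Sel c i) = c"

abbreviation tree_trm :: "cd_fun trm \<Rightarrow> nat trm" where
  "tree_trm \<equiv> map_trm ctor_of"

text \<open>\<open>Pred\<close> gets the default \<open>Falsum\<close>: the source language has no
  predicate symbols, so \<open>formula_over\<close> excludes this case.\<close>

primrec relativize :: "(cd_fun, 'p) fm \<Rightarrow> (nat, sort) fm" where
  "relativize Falsum = Falsum"
| "relativize (Eq t u) = Eq (tree_trm t) (tree_trm u)"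
| "relativize (Pred p ts) = Falsum"
| "relativize (Neg \<phi>) = Neg (relativize \<phi>)"
| "relativize (Conj \<phi> \<psi>) = Conj (relativize \<phi>) (relativize \<psi>)"
| "relativize (Disj \<phi> \<psi>) = Disj (relativize \<phi>) (relativize \<psi>)"
| "relativize (Impl \<phi> \<psi>) = Impl (relativize \<phi>) (relativize \<psi>)"
| "relativize (Forall s x \<phi>) = Forall s x
     (if is_data s then Impl (Pred s [Var s x]) (relativize \<phi>) else relativize \<phi>)"
| "relativize (Exists s x \<phi>) = Exists s x
     (if is_data s then Conj (Pred s [Var s x]) (relativize \<phi>) else relativize \<phi>)"

definition to_tree_fm :: "(cd_fun, 'p) fm \<Rightarrow> (nat, sort) fm" where
  "to_tree_fm \<phi> = Conj (relativize \<phi>) (fin_fm \<phi>)"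


section \<open>Effectiveness of the translation\<close>

lemma even_sort_code: "even (sort_code s) \<longleftrightarrow> is_data s"
  by (cases s) auto

text \<open>A positive tag makes the codes of the parts strictly smaller, so \<open>lookup\<close>
  finds their values. Tag \<open>0\<close> belongs to variables and \<open>Falsum\<close>, which
  have no parts to recurse on.\<close>

lemma less_prod_encode: "0 < i \<Longrightarrow> m < prod_encode (i, m)"
  by (cases i) (auto simp: prod_encode_def)

lemma less_prod_encode_fst: "0 < i \<Longrightarrow> a < prod_encode (i, prod_encode (a, b))"
  by (rule le_less_trans[OF le_prod_encode_1 less_prod_encode])

lemma less_prod_encode_snd: "0 < i \<Longrightarrow> b < prod_encode (i, prod_encode (a, b))"
  by (rule le_less_trans[OF le_prod_encode_2 less_prod_encode])

definition verum_code :: nat where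
  "verum_code = prod_encode (3, prod_encode (0, 0))"

definition conj_code :: "nat \<Rightarrow> nat \<Rightarrow> nat" where
  "conj_code a b = prod_encode (4, prod_encode (a, b))"

text \<open>The code of \<open>fin\<^sub>s(x)\<close> from the paired codes of \<open>s\<close> and \<open>x\<close>.\<close>

definition fin_code :: "nat \<Rightarrow> nat" where
  "fin_code v = prod_encode (2, prod_encode (pfst v, Suc (prod_encode (prod_encode (0, v), 0))))"

lemma rec_fun_conj_code [rec_intros]:
  "rec_fun k a \<Longrightarrow> rec_fun k b \<Longrightarrow> rec_fun k (\<lambda>xs. conj_code (a xs) (b xs))"
  unfolding conj_code_def by (intro rec_intros)

lemma rec_fun_fin_code [rec_intros]: "rec_fun k a \<Longrightarrow> rec_fun k (\<lambda>xs. fin_code (a xs))"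
  unfolding fin_code_def by (intro rec_intros)

lemma tree_fm_code_simps:
  "tree_fm_code (Neg Falsum) = verum_code"
  "tree_fm_code (Conj \<phi> \<psi>) = conj_code (tree_fm_code \<phi>) (tree_fm_code \<psi>)"
  "tree_fm_code (Pred s [Var s x]) = fin_code (prod_encode (sort_code s, x))"
  by (simp_all add: tree_fm_code_def verum_code_def conj_code_def fin_code_def)

text \<open>A number is read both as the code of a term and as the code of a list of terms, and the
  results of both readings are paired, which makes the mutual recursion a simple one.\<close>

definition fin_trm_step :: "nat \<Rightarrow> nat \<Rightarrow> nat" where
  "fin_trm_step n h = prod_encode
     (if pfst n = 0
      then (if even (pfst (psnd n)) then fin_code (psnd n) else verum_code)
      else psnd (lookup n h (psnd (psnd n))),
      if n = 0 then verum_code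
      else conj_code (pfst (lookup n h (pfst (n - 1)))) (psnd (lookup n h (psnd (n - 1)))))"

definition fin_trm_code :: "nat \<Rightarrow> nat" where
  "fin_trm_code n = pfst (cov fin_trm_step n)"

lemma rec_fun_fin_trm_code [rec_intros]:
  assumes "rec_fun k a"
  shows "rec_fun k (\<lambda>xs. fin_trm_code (a xs))"
  unfolding fin_trm_code_def
  by (intro rec_fun_pfst rec_fun_cov assms) (unfold fin_trm_step_def, intro rec_intros)

text \<open>\<open>cf\<close> is arbitrary because codes of function symbols are skipped. An inner
  induction on the argument list handles the second component of
  \<open>fin_trm_step\<close>.\<close>

lemma fin_trm_code_correct: "fin_trm_code (trm_code cf t) = tree_fm_code (fin_trm t)"
proof (induction t)
  case (Var s x)
  show ?case
    by (simp add: fin_trm_code_def cov_def fin_trm_step_def tree_fm_code_simps even_sort_code)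
next
  case (Fn f ts)
  have "psnd (cov fin_trm_step (list_encode (map (trm_code cf) ts))) =
      tree_fm_code (foldr Conj (map fin_trm ts) (Neg Falsum))"
    using Fn
  proof (induction ts)
    case Nil
    show ?case by (simp add: cov_def fin_trm_step_def tree_fm_code_simps)
  next
    case (Cons t ts)
    let ?l = "list_encode (map (trm_code cf) (t # ts))"
    \<comment> \<open>The successor in \<open>list_encode\<close> makes both inequalities
      strict.\<close>
    have "trm_code cf t < ?l" "list_encode (map (trm_code cf) ts) < ?l"
      by (simp_all add: less_Suc_eq_le le_prod_encode_1 le_prod_encode_2)
    moreover have "pfst (cov fin_trm_step (trm_code cf t)) = tree_fm_code (fin_trm t)"
      using Cons.prems by (simp flip: fin_trm_code_def)
    moreover have "psnd (cov fin_trm_step (list_encode (map (trm_code cf) ts))) =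
        tree_fm_code (foldr Conj (map fin_trm ts) (Neg Falsum))"
      using Cons by simp
    \<comment> \<open>Unfolding only at codes of the form \<open>Suc _\<close> opens the outer code
      and leaves the values at smaller codes to the facts above.\<close>
    ultimately show ?case
      by (simp add: cov_def[of _ "Suc _"] fin_trm_step_def[of "Suc _"] lookup_history tree_fm_code_simps)
  qed
  then show ?case
    by (simp add: fin_trm_code_def cov_def[of _ "prod_encode _"] fin_trm_step_def lookup_history
        less_prod_encode_snd)
qed

text \<open>One run yields the codes of \<open>relativize\<close> and \<open>fin_fm\<close> as a
  pair. An equation keeps its code \<open>n\<close>; the guards of quantifiers use tag 6 for
  \<open>Impl\<close> and 4 for \<open>Conj\<close>. The \<open>0\<close> in the last branch is the
  code of \<open>Falsum\<close>.\<close>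

definition fm_step :: "nat \<Rightarrow> nat \<Rightarrow> nat" where
  "fm_step n h =
     (let i = pfst n; m = psnd n; a = lookup n h (pfst m); b = lookup n h (psnd m);
          c = lookup n h m
      in if i = 1 then prod_encode (n, conj_code (fin_trm_code (pfst m)) (fin_trm_code (psnd m)))
      else if i = 3 then prod_encode (prod_encode (3, pfst c), psnd c)
      else if i = 4 \<or> i = 5 \<or> i = 6 then
        prod_encode (prod_encode (i, prod_encode (pfst a, pfst b)), conj_code (psnd a) (psnd b))
      else if i = 7 \<or> i = 8 then
        prod_encode (prod_encode (i, prod_encode (pfst m,
          if even (pfst (pfst m))
          then prod_encode (if i = 7 then 6 else 4, prod_encode (fin_code (pfst m), pfst b))
          else pfst b)), psnd b)
      else prod_encode (0, verum_code))"

lemma rec_fun_fm_step: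
  assumes [rec_intros]: "rec_fun k a" "rec_fun k b"
  shows "rec_fun k (\<lambda>xs. fm_step (a xs) (b xs))"
proof -
  \<comment> \<open>The closure rule for conditionals tests one equation at a time, so disjunctions
    become nested conditionals.\<close>
  have disj: "(if P \<or> Q then x else y) = (if P then x else if Q then x else y)" for P Q and x y :: nat
    by simp
  show ?thesis unfolding fm_step_def Let_def disj by (intro rec_intros)
qed

text \<open>A constructor \<open>c\<close> and its generator share the code \<open>2 * c\<close>;
  this is why \<open>fm_step\<close> may return equations unchanged.\<close>

lemma trm_code_tree_trm:
  assumes "\<And>c i. Sel c i \<notin> funs_trm t"
  shows "trm_code ((*) 2) (tree_trm t) = trm_code cd_fun_code t"
  using assms
proof (induction t)
  case (Fn f ts)
  have "2 * ctor_of f = cd_fun_code f"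
    using Fn.prems by (cases f) auto
  moreover have "map (trm_code ((*) 2) \<circ> tree_trm) ts = map (trm_code cd_fun_code) ts"
    using Fn by auto
  ultimately show ?case by (simp del: map_eq_conv)
qed simp

text \<open>All recursive calls go to strictly smaller codes, where \<open>lookup_history\<close>
  reduces them to the induction hypotheses.\<close>

lemma cov_fm_step:
  assumes "selector_free \<phi>"
  shows "cov fm_step (cd_fm_code \<phi>) =
    prod_encode (tree_fm_code (relativize \<phi>), tree_fm_code (fin_fm \<phi>))"
  using assms
proof (induction \<phi>)
  case Falsum
  show ?case
    by (simp add: cov_def fm_step_def tree_fm_code_simps cd_fm_code_def)
      (simp add: tree_fm_code_def prod_encode_def)
next
  case (Eq t u)
  then have "trm_code ((*) 2) (tree_trm t) = trm_code cd_fun_code t"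
    "trm_code ((*) 2) (tree_trm u) = trm_code cd_fun_code u"
    by (auto simp: selector_free_def intro!: trm_code_tree_trm)
  then show ?case
    by (simp add: cov_def fm_step_def tree_fm_code_simps cd_fm_code_def fin_trm_code_correct)
      (simp add: tree_fm_code_def)
next
  case (Pred p ts)
  show ?case
    by (simp add: cov_def fm_step_def tree_fm_code_simps cd_fm_code_def)
      (simp add: tree_fm_code_def prod_encode_def)
next
  case (Neg \<phi>)
  then show ?case
    by (simp add: selector_free_def cd_fm_code_def cov_def[of _ "prod_encode _"] fm_step_def
        lookup_history less_prod_encode) (simp add: tree_fm_code_def)
next
  case (Conj \<phi> \<psi>)
  then show ?case
    by (simp add: selector_free_def cd_fm_code_def cov_def[of _ "prod_encode _"] fm_step_def
        lookup_history less_prod_encode_fst less_prod_encode_snd tree_fm_code_simps)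
      (simp add: conj_code_def)
next
  case (Disj \<phi> \<psi>)
  then show ?case
    by (simp add: selector_free_def cd_fm_code_def cov_def[of _ "prod_encode _"] fm_step_def
        lookup_history less_prod_encode_fst less_prod_encode_snd tree_fm_code_simps)
      (simp add: tree_fm_code_def)
next
  case (Impl \<phi> \<psi>)
  then show ?case
    by (simp add: selector_free_def cd_fm_code_def cov_def[of _ "prod_encode _"] fm_step_def
        lookup_history less_prod_encode_fst less_prod_encode_snd tree_fm_code_simps)
      (simp add: tree_fm_code_def)
next
  case (Forall s x \<phi>)
  then show ?case
    by (simp add: selector_free_def cd_fm_code_def cov_def[of _ "prod_encode _"] fm_step_def
        lookup_history less_prod_encode_snd even_sort_code flip: tree_fm_code_simps)
      (simp add: tree_fm_code_def)
next
  case (Exists s x \<phi>)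
  then show ?case
    by (simp add: selector_free_def cd_fm_code_def cov_def[of _ "prod_encode _"] fm_step_def
        lookup_history less_prod_encode_snd even_sort_code flip: tree_fm_code_simps)
      (simp add: tree_fm_code_def)
qed

lemma effective_to_tree_fm: "effective_on {\<phi>. selector_free \<phi>} cd_fm_code tree_fm_code to_tree_fm"
proof -
  let ?f = "\<lambda>n. conj_code (pfst (cov fm_step n)) (psnd (cov fm_step n))"
  have "rec_fun 1 (\<lambda>xs. ?f (xs ! 0))"
    by (intro rec_intros rec_fun_cov rec_fun_fm_step) simp_all
  then obtain r where "\<And>n. recf_eval r [n] (?f n)"
    unfolding rec_fun_def by (metis One_nat_def length_Cons list.size(3) nth_Cons_0)
  moreover have "?f (cd_fm_code \<phi>) = tree_fm_code (to_tree_fm \<phi>)" if "selector_free \<phi>" for \<phi>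
    using cov_fm_step[OF that] by (simp add: to_tree_fm_def tree_fm_code_simps)
  ultimately show ?thesis unfolding effective_on_def by (metis mem_Collect_eq)
qed


section \<open>Sorts and evaluation of terms\<close>

primrec vars_trm :: "'f trm \<Rightarrow> (sort \<times> nat) set" where
  "vars_trm (Var s x) = {(s, x)}"
| "vars_trm (Fn f ts) = \<Union> (set (map vars_trm ts))"

text \<open>Bound occurrences count too, matching \<open>fin_fm\<close>; a quantifier prefix by
  itself contributes nothing.\<close>

primrec vars_fm :: "('f, 'p) fm \<Rightarrow> (sort \<times> nat) set" where
  "vars_fm Falsum = {}"
| "vars_fm (Eq t u) = vars_trm t \<union> vars_trm u"
| "vars_fm (Pred p ts) = {}"
| "vars_fm (Neg \<phi>) = vars_fm \<phi>"
| "vars_fm (Conj \<phi> \<psi>) = vars_fm \<phi> \<union> vars_fm \<psi>"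
| "vars_fm (Disj \<phi> \<psi>) = vars_fm \<phi> \<union> vars_fm \<psi>"
| "vars_fm (Impl \<phi> \<psi>) = vars_fm \<phi> \<union> vars_fm \<psi>"
| "vars_fm (Forall s x \<phi>) = vars_fm \<phi>"
| "vars_fm (Exists s x \<phi>) = vars_fm \<phi>"

lemma ground_vars_trm: "ground t \<Longrightarrow> vars_trm t = {}"
  by (induction t) (auto simp: list_all_iff)

lemma eval_trm_cong:
  "(\<And>s x. (s, x) \<in> vars_trm t \<Longrightarrow> v s x = w s x) \<Longrightarrow> eval_trm A v t = eval_trm A w t"
proof (induction t)
  case (Fn f ts)
  then have "map (eval_trm A v) ts = map (eval_trm A w) ts" by fastforce
  then show ?case by (simp del: map_eq_conv)
qed simp

lemma vars_tree_trm [simp]: "vars_trm (tree_trm t) = vars_trm t"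
  by (induction t) auto

lemma sat_relativize_cong:
  "(\<And>s x. (s, x) \<in> vars_fm \<phi> \<Longrightarrow> v s x = w s x) \<Longrightarrow>
    sat (tree_structure \<Sigma>) v (relativize \<phi>) \<longleftrightarrow> sat (tree_structure \<Sigma>) w (relativize \<phi>)"
proof (induction \<phi> arbitrary: v w)
  case (Eq t u)
  then have "eval_trm A v (tree_trm t) = eval_trm A w (tree_trm t)"
    "eval_trm A v (tree_trm u) = eval_trm A w (tree_trm u)" for A :: "(nat, sort, ctree) struct"
    by (auto intro!: eval_trm_cong)
  then show ?case by simp
next
  case (Neg \<phi>)
  from Neg.IH[of v w] Neg.prems show ?case by simp
next
  case (Conj \<phi> \<psi>)
  from Conj.IH(1)[of v w] Conj.IH(2)[of v w] Conj.prems show ?case by simp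
next
  case (Disj \<phi> \<psi>)
  from Disj.IH(1)[of v w] Disj.IH(2)[of v w] Disj.prems show ?case by simp
next
  case (Impl \<phi> \<psi>)
  from Impl.IH(1)[of v w] Impl.IH(2)[of v w] Impl.prems show ?case by simp
next
  case (Forall s x \<phi>)
  \<comment> \<open>Both updates give \<open>x\<close> the value \<open>a\<close>, so the guard and
    the body agree even where \<open>v\<close> and \<open>w\<close> differ at
    \<open>x\<close>.\<close>
  have "sat (tree_structure \<Sigma>) (upd v s x a) (relativize \<phi>) \<longleftrightarrow>
      sat (tree_structure \<Sigma>) (upd w s x a) (relativize \<phi>)" for a
    using Forall.prems by (intro Forall.IH) (auto simp: upd_def)
  then show ?case by (simp add: upd_def)
next
  case (Exists s x \<phi>)
  have "sat (tree_structure \<Sigma>) (upd v s x a) (relativize \<phi>) \<longleftrightarrow>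
      sat (tree_structure \<Sigma>) (upd w s x a) (relativize \<phi>)" for a
    using Exists.prems by (intro Exists.IH) (auto simp: upd_def)
  then show ?case by (simp add: upd_def)
qed auto

lemma sat_foldr_Conj: "sat A v (foldr Conj \<phi>s \<psi>) \<longleftrightarrow> (\<forall>\<phi>\<in>set \<phi>s. sat A v \<phi>) \<and> sat A v \<psi>"
  by (induction \<phi>s) auto

lemma sat_fin_trm:
  "sat A v (fin_trm t) \<longleftrightarrow> (\<forall>(s, x)\<in>vars_trm t. is_data s \<longrightarrow> pred_interp A s [v s x])"
  by (induction t) (auto simp: sat_foldr_Conj)

lemma sat_fin_fm:
  "sat A v (fin_fm \<phi>) \<longleftrightarrow> (\<forall>(s, x)\<in>vars_fm \<phi>. is_data s \<longrightarrow> pred_interp A s [v s x])"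
  by (induction \<phi>) (auto simp: sat_fin_trm)

section \<open>Well-sortedness of the translated formulas\<close>

lemma has_sort_vars: "has_sort L s t \<Longrightarrow> (r, x) \<in> vars_trm t \<Longrightarrow> r \<in> sorts L"
  by (induction rule: has_sort.induct) (auto simp: list_all2_conv_all_nth in_set_conv_nth)

lemma formula_over_vars:
  "formula_over L \<phi> \<Longrightarrow> (s, x) \<in> vars_fm \<phi> \<Longrightarrow> s \<in> sorts L"
  by (induction \<phi>) (auto dest: has_sort_vars)

lemma has_sort_tree_trm:
  assumes "has_sort (cd_language \<Sigma>) s t" "\<And>c i. Sel c i \<notin> funs_trm t"
  shows "has_sort (tree_language \<Sigma>) s (tree_trm t)"
  using assms
proof (induction rule: has_sort.induct)
  case (1 s x)
  then show ?case by (auto intro: has_sort.intros simp: cd_language_def tree_language_def)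
next
  case (2 f ts)
  then obtain c where f: "f = Ctor c" by (cases f) auto
  have "list_all2 (has_sort (tree_language \<Sigma>)) (ctor_args \<Sigma> c) (map tree_trm ts)"
    using 2(2,3) f by (auto simp: list_all2_conv_all_nth cd_language_def)
  with 2(1) f show ?case
    using has_sort.intros(2)[of c "tree_language \<Sigma>" "map tree_trm ts"]
    by (auto simp: cd_language_def tree_language_def)
qed

lemma formula_over_foldr_Conj:
  "formula_over L (foldr Conj \<phi>s \<psi>) \<longleftrightarrow> (\<forall>\<phi>\<in>set \<phi>s. formula_over L \<phi>) \<and> formula_over L \<psi>"
  by (induction \<phi>s) auto

lemma formula_over_fin_Pred:
  "s \<in> csorts \<Sigma> \<Longrightarrow> formula_over (tree_language \<Sigma>) (Pred s [Var s x])"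
  by (simp add: tree_language_def has_sort.intros)

lemma formula_over_fin_trm:
  "(\<And>s x. (s, x) \<in> vars_trm t \<Longrightarrow> s \<in> csorts \<Sigma>) \<Longrightarrow> formula_over (tree_language \<Sigma>) (fin_trm t)"
proof (induction t)
  case (Var s x)
  then show ?case using formula_over_fin_Pred[of s \<Sigma> x] by auto
qed (auto simp: formula_over_foldr_Conj)

lemma formula_over_fin_fm:
  "(\<And>s x. (s, x) \<in> vars_fm \<phi> \<Longrightarrow> s \<in> csorts \<Sigma>) \<Longrightarrow> formula_over (tree_language \<Sigma>) (fin_fm \<phi>)"
  by (induction \<phi>) (auto intro: formula_over_fin_trm)

lemma formula_over_relativize:
  "formula_over (cd_language \<Sigma>) \<phi> \<Longrightarrow> selector_free \<phi> \<Longrightarrow>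
    formula_over (tree_language \<Sigma>) (relativize \<phi>)"
proof (induction \<phi>)
  case (Eq t u)
  then show ?case by (auto simp: selector_free_def intro!: has_sort_tree_trm)
next
  case (Forall s x \<phi>)
  then show ?case using formula_over_fin_Pred[of s \<Sigma> x]
    by (auto simp: selector_free_def cd_language_def tree_language_def)
next
  case (Exists s x \<phi>)
  then show ?case using formula_over_fin_Pred[of s \<Sigma> x]
    by (auto simp: selector_free_def cd_language_def tree_language_def)
qed (auto simp: selector_free_def)

lemma formula_over_to_tree_fm:
  assumes "formula_over (cd_language \<Sigma>) \<phi>" "selector_free \<phi>"
  shows "formula_over (tree_language \<Sigma>) (to_tree_fm \<phi>)"
  using formula_over_relativize[OF assms] formula_over_fin_fm[of \<phi> \<Sigma>]
    formula_over_vars[OF assms(1)]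
  by (auto simp: to_tree_fm_def cd_language_def)


section \<open>Equisatisfiability\<close>

text \<open>The nodes are the root and finitely many images of the children's node sets under
  prefixing, which is injective.\<close>

lemma finite_tree_Node: "finite_tree (Node c ts) \<longleftrightarrow> (\<forall>t\<in>set ts. finite_tree t)"
proof -
  have "is_node (Node c ts) p \<longleftrightarrow> p = [] \<or> (\<exists>i q. p = i # q \<and> i < length ts \<and> is_node (ts ! i) q)" for p
    by (subst is_node.simps) auto
  then have nodes: "{p. is_node (Node c ts) p} =
      insert [] (\<Union>i<length ts. (#) i ` {p. is_node (ts ! i) p})"
    by auto
  have "finite ((#) i ` P) \<longleftrightarrow> finite P" for i :: nat and P
    by (rule finite_image_iff) simp
  then show ?thesis
    unfolding finite_tree_def nodes by (auto simp: all_set_conv_all_nth)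
qed

lemma tree_of_sort_Node:
  "tree_of_sort \<Sigma> s (Node c ts) \<longleftrightarrow>
    c \<in> ctors \<Sigma> \<and> s = ctor_res \<Sigma> c \<and> list_all2 (tree_of_sort \<Sigma>) (ctor_args \<Sigma> c) ts"
  by (subst tree_of_sort.simps) auto

text \<open>The carrier shared by all structures of (co)datatypes, available before any structure is
  chosen.\<close>

definition cd_universe :: "ctor_sig \<Rightarrow> sort \<Rightarrow> ctree set" where
  "cd_universe \<Sigma> s = {t. tree_of_sort \<Sigma> s t \<and> (is_data s \<longrightarrow> finite_tree t)}"

lemma cd_structure_universe:
  "cd_structure \<Sigma> A \<Longrightarrow> s \<in> csorts \<Sigma> \<Longrightarrow> universe A s = cd_universe \<Sigma> s"
  by (cases s) (auto simp: cd_structure_def cd_universe_def)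

lemma ctor_args_sorts:
  assumes "cd_signature \<Sigma>" "c \<in> ctors \<Sigma>" "i < length (ctor_args \<Sigma> c)"
  shows "ctor_args \<Sigma> c ! i \<in> csorts \<Sigma>"
proof -
  have "set (ctor_args \<Sigma> c) \<subseteq> csorts \<Sigma>"
    using assms(1,2) unfolding cd_signature_def by blast
  with assms(3) show ?thesis by auto
qed

text \<open>No constructor mixes datatypes with codatatypes, so finiteness is demanded of the tree
  exactly when it is demanded of its children.\<close>

lemma Node_in_cd_universe:
  assumes "cd_signature \<Sigma>" "c \<in> ctors \<Sigma>"
  shows "Node c ts \<in> cd_universe \<Sigma> (ctor_res \<Sigma> c) \<longleftrightarrow>
    list_all2 (\<lambda>s t. t \<in> cd_universe \<Sigma> s) (ctor_args \<Sigma> c) ts"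
proof -
  have data: "is_data s \<longleftrightarrow> is_data (ctor_res \<Sigma> c)" if "s \<in> set (ctor_args \<Sigma> c)" for s
  proof -
    have "is_codata r \<longleftrightarrow> \<not> is_data r" for r by (cases r) auto
    then show ?thesis using assms that unfolding cd_signature_def by metis
  qed
  have "list_all2 (\<lambda>s t. t \<in> cd_universe \<Sigma> s) (ctor_args \<Sigma> c) ts \<longleftrightarrow>
      list_all2 (tree_of_sort \<Sigma>) (ctor_args \<Sigma> c) ts \<and>
      (is_data (ctor_res \<Sigma> c) \<longrightarrow> (\<forall>t\<in>set ts. finite_tree t))"
    using data by (auto simp: cd_universe_def list_all2_conv_all_nth all_set_conv_all_nth)
  then show ?thesis
    using assms(2) by (auto simp: cd_universe_def tree_of_sort_Node finite_tree_Node)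
qed

text \<open>Only the occurring variables are constrained, so a ground term may be evaluated under
  any assignment.\<close>

lemma eval_tree_trm_in_universe:
  assumes \<Sigma>: "cd_signature \<Sigma>" and "has_sort (cd_language \<Sigma>) s t" "\<And>c i. Sel c i \<notin> funs_trm t"
    and "\<And>r x. (r, x) \<in> vars_trm t \<Longrightarrow> v r x \<in> cd_universe \<Sigma> r"
  shows "eval_trm (tree_structure \<Sigma>) v (tree_trm t) \<in> cd_universe \<Sigma> s"
  using assms(2-)
proof (induction rule: has_sort.induct)
  case (2 f ts)
  then obtain c where f: "f = Ctor c" by (cases f) auto
  have c: "c \<in> ctors \<Sigma>" using 2(1) f by (auto simp: cd_language_def)
  have "list_all2 (\<lambda>s t. t \<in> cd_universe \<Sigma> s) (ctor_args \<Sigma> c)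
      (map (eval_trm (tree_structure \<Sigma>) v \<circ> tree_trm) ts)"
  proof (rule list_all2_all_nthI)
    show len: "length (ctor_args \<Sigma> c) = length (map (eval_trm (tree_structure \<Sigma>) v \<circ> tree_trm) ts)"
      using list_all2_lengthD[OF 2(2)] f by (simp add: cd_language_def)
    fix i assume "i < length (ctor_args \<Sigma> c)"
    then have i: "i < length ts" using len by simp
    then have "Sel c' j \<notin> funs_trm (ts ! i)" for c' j
      using 2(3)[of c' j] nth_mem[OF i] by auto
    moreover have "v r x \<in> cd_universe \<Sigma> r" if "(r, x) \<in> vars_trm (ts ! i)" for r x
      using 2(4)[of r x] nth_mem[OF i] that by auto
    ultimately have "eval_trm (tree_structure \<Sigma>) v (tree_trm (ts ! i)) \<in>
        cd_universe \<Sigma> (fun_args (cd_language \<Sigma>) f ! i)"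
      using list_all2_nthD2[OF 2(2) i] by blast
    then show "map (eval_trm (tree_structure \<Sigma>) v \<circ> tree_trm) ts ! i \<in>
        cd_universe \<Sigma> (ctor_args \<Sigma> c ! i)"
      using i f by (simp add: cd_language_def)
  qed
  with Node_in_cd_universe[OF \<Sigma> c] f show ?case
    by (simp add: cd_language_def tree_structure_def comp_def)
qed auto

text \<open>\<open>cd_structure\<close> fixes a constructor only on arguments from the universes, so
  the argument values must first be shown to lie there.\<close>

lemma eval_tree_trm:
  assumes \<Sigma>: "cd_signature \<Sigma>" and A: "cd_structure \<Sigma> A"
    and "has_sort (cd_language \<Sigma>) s t" "\<And>c i. Sel c i \<notin> funs_trm t"
    and v: "assignment_into (cd_language \<Sigma>) A v"
  shows "eval_trm A v t = eval_trm (tree_structure \<Sigma>) v (tree_trm t)"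
  using assms(3,4)
proof (induction rule: has_sort.induct)
  case (2 f ts)
  then obtain c where f: "f = Ctor c" by (cases f) auto
  have c: "c \<in> ctors \<Sigma>" using 2(1) f by (auto simp: cd_language_def)
  have in_univ: "v r x \<in> cd_universe \<Sigma> r" if "r \<in> csorts \<Sigma>" for r x
    using v cd_structure_universe[OF A that] that
    by (auto simp: assignment_into_def cd_language_def)
  let ?us = "map (eval_trm (tree_structure \<Sigma>) v \<circ> tree_trm) ts"
  have "list_all2 (\<lambda>s t. t \<in> universe A s) (ctor_args \<Sigma> c) ?us"
  proof (rule list_all2_all_nthI)
    fix i assume i: "i < length (ctor_args \<Sigma> c)"
    let ?s = "ctor_args \<Sigma> c ! i"
    have "has_sort (cd_language \<Sigma>) ?s (ts ! i)" and len: "i < length ts"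
      using 2(2) i f by (auto simp: list_all2_conv_all_nth cd_language_def)
    then have "eval_trm (tree_structure \<Sigma>) v (tree_trm (ts ! i)) \<in> cd_universe \<Sigma> ?s"
      using 2(3) has_sort_vars[of "cd_language \<Sigma>" ?s "ts ! i"]
      by (intro eval_tree_trm_in_universe[OF \<Sigma>] in_univ) (auto simp: cd_language_def)
    moreover have "?s \<in> csorts \<Sigma>"
      by (rule ctor_args_sorts[OF \<Sigma> c i])
    ultimately show "?us ! i \<in> universe A ?s"
      using cd_structure_universe[OF A] len by simp
  qed (use 2(2) f in \<open>auto simp: cd_language_def dest: list_all2_lengthD\<close>)
  then have "fun_interp A (Ctor c) ?us = Node c ?us"
    using A c by (auto simp: cd_structure_def)
  moreover have "map (eval_trm A v) ts = ?us"
  proof (rule map_cong)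
    fix t assume t: "t \<in> set ts"
    then have "Sel c i \<notin> funs_trm t" for c i using 2(3)[of c i] by auto
    with t show "eval_trm A v t = (eval_trm (tree_structure \<Sigma>) v \<circ> tree_trm) t"
      using 2(2) by (auto simp: list_all2_conv_all_nth in_set_conv_nth)
  qed simp
  ultimately show ?case
    using f by (simp add: tree_structure_def comp_def del: map_eq_conv)
qed simp

lemma assignment_into_upd:
  "assignment_into L A v \<Longrightarrow> a \<in> universe A s \<Longrightarrow> assignment_into L A (upd v s x a)"
  by (auto simp: assignment_into_def upd_def)

text \<open>The guard cuts the range of a datatype quantifier down to the finite trees, which form
  the universe of that sort in \<open>A\<close>; codatatype ranges already agree.\<close>

lemma sat_relativize:
  assumes \<Sigma>: "cd_signature \<Sigma>" and A: "cd_structure \<Sigma> A"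
    and "formula_over (cd_language \<Sigma>) \<phi>" "selector_free \<phi>" "assignment_into (cd_language \<Sigma>) A v"
  shows "sat A v \<phi> \<longleftrightarrow> sat (tree_structure \<Sigma>) v (relativize \<phi>)"
  using assms(3-)
proof (induction \<phi> arbitrary: v)
  case (Eq t u)
  then have "eval_trm A v t = eval_trm (tree_structure \<Sigma>) v (tree_trm t)"
    "eval_trm A v u = eval_trm (tree_structure \<Sigma>) v (tree_trm u)"
    by (auto simp: selector_free_def intro!: eval_tree_trm[OF \<Sigma> A])
  then show ?case by simp
next
  case (Pred p ts)
  then show ?case by (simp add: cd_language_def)
next
  case (Forall s x \<phi>)
  then have U: "universe A s = cd_universe \<Sigma> s"
    by (intro cd_structure_universe[OF A]) (simp add: cd_language_def)
  have "sat A (upd v s x a) \<phi> \<longleftrightarrow> sat (tree_structure \<Sigma>) (upd v s x a) (relativize \<phi>)"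
    if "a \<in> cd_universe \<Sigma> s" for a
    using Forall.IH[of "upd v s x a"] Forall.prems U that
    by (simp add: selector_free_def assignment_into_upd)
  with U show ?case
    by (auto simp: cd_universe_def tree_structure_def upd_def)
next
  case (Exists s x \<phi>)
  then have U: "universe A s = cd_universe \<Sigma> s"
    by (intro cd_structure_universe[OF A]) (simp add: cd_language_def)
  have "sat A (upd v s x a) \<phi> \<longleftrightarrow> sat (tree_structure \<Sigma>) (upd v s x a) (relativize \<phi>)"
    if "a \<in> cd_universe \<Sigma> s" for a
    using Exists.IH[of "upd v s x a"] Exists.prems U that
    by (simp add: selector_free_def assignment_into_upd)
  with U show ?case
    by (auto simp: cd_universe_def tree_structure_def upd_def)
qed (auto simp: selector_free_def)

lemma data_universe_nonempty:
  assumes "cd_signature \<Sigma>" "s \<in> csorts \<Sigma>" "is_data s"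
  shows "\<exists>t. t \<in> cd_universe \<Sigma> s"
proof -
  obtain t where t: "ground_ctor_term \<Sigma> s t"
    using assms unfolding cd_signature_def by blast
  \<comment> \<open>A ground term has no variables, so the assignment \<open>undefined\<close> is
    admissible.\<close>
  then have "eval_trm (tree_structure \<Sigma>) undefined (tree_trm t) \<in> cd_universe \<Sigma> s"
    using ground_vars_trm[of t]
    by (intro eval_tree_trm_in_universe[OF assms(1)]) (auto simp: ground_ctor_term_def)
  then show ?thesis by blast
qed

text \<open>\<open>d\<close> supplies the value of a selector on trees built by another
  constructor.\<close>

lemma cd_structure_exists:
  assumes \<Sigma>: "cd_signature \<Sigma>" and d: "\<And>s. s \<in> csorts \<Sigma> \<Longrightarrow> d s \<in> cd_universe \<Sigma> s"
  shows "\<exists>A. cd_structure \<Sigma> A"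
proof -
  define A :: "(cd_fun, unit, ctree) struct" where
    "A = \<lparr>universe = cd_universe \<Sigma>,
          fun_interp = (\<lambda>f ts. case f of Ctor c \<Rightarrow> Node c ts
            | Sel c i \<Rightarrow> if root (hd ts) = c then children (hd ts) ! i else d (ctor_args \<Sigma> c ! i)),
          pred_interp = (\<lambda>_ _. False)\<rparr>"
  have "children t ! i \<in> cd_universe \<Sigma> (ctor_args \<Sigma> c ! i)"
    if "c \<in> ctors \<Sigma>" "i < length (ctor_args \<Sigma> c)" "t \<in> cd_universe \<Sigma> (ctor_res \<Sigma> c)" "root t = c"
    for c i t
    using Node_in_cd_universe[OF \<Sigma> that(1), of "children t"] that
    by (cases t) (auto simp: list_all2_conv_all_nth)
  moreover have "d (ctor_args \<Sigma> c ! i) \<in> cd_universe \<Sigma> (ctor_args \<Sigma> c ! i)"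
    if "c \<in> ctors \<Sigma>" "i < length (ctor_args \<Sigma> c)" for c i
    using ctor_args_sorts[OF \<Sigma> that] by (rule d)
  moreover have "is_codata s \<Longrightarrow> \<not> is_data s" for s
    by (cases s) auto
  ultimately have "cd_structure \<Sigma> A"
    by (auto simp: cd_structure_def A_def cd_universe_def)
  then show ?thesis by blast
qed

lemma cd_satisfiable_iff:
  assumes \<Sigma>: "cd_signature \<Sigma>" and \<phi>: "formula_over (cd_language \<Sigma>) \<phi>" "selector_free \<phi>"
  shows "cd_satisfiable \<Sigma> \<phi> \<longleftrightarrow> tree_satisfiable \<Sigma> (to_tree_fm \<phi>)"
proof
  assume "cd_satisfiable \<Sigma> \<phi>"
  then obtain A v where A: "cd_structure \<Sigma> A" and v: "assignment_into (cd_language \<Sigma>) A v"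
    and "sat A v \<phi>"
    by (auto simp: cd_satisfiable_def satisfiable_in_def)
  then have "sat (tree_structure \<Sigma>) v (relativize \<phi>)"
    using sat_relativize[OF \<Sigma> A \<phi> v] by simp
  moreover have univ: "v s x \<in> cd_universe \<Sigma> s" if "s \<in> csorts \<Sigma>" for s x
    using v cd_structure_universe[OF A that] that
    by (auto simp: assignment_into_def cd_language_def)
  \<comment> \<open>\<open>v\<close> has finite values at all datatype variables of the signature,
    including those bound in the formula.\<close>
  moreover have "sat (tree_structure \<Sigma>) v (fin_fm \<phi>)"
    using univ formula_over_vars[OF \<phi>(1)]
    by (fastforce simp: sat_fin_fm tree_structure_def cd_universe_def cd_language_def)
  ultimately show "tree_satisfiable \<Sigma> (to_tree_fm \<phi>)"
    by (auto simp: tree_satisfiable_def satisfiable_in_def to_tree_fm_def assignment_into_def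
        tree_language_def tree_structure_def cd_universe_def)
next
  assume "tree_satisfiable \<Sigma> (to_tree_fm \<phi>)"
  then obtain v where v: "\<And>s x. s \<in> csorts \<Sigma> \<Longrightarrow> tree_of_sort \<Sigma> s (v s x)"
    and sat: "sat (tree_structure \<Sigma>) v (relativize \<phi>)"
    and "sat (tree_structure \<Sigma>) v (fin_fm \<phi>)"
    by (auto simp: tree_satisfiable_def satisfiable_in_def to_tree_fm_def assignment_into_def
        tree_language_def) (auto simp: tree_structure_def)
  then have fin: "finite_tree (v s x)" if "(s, x) \<in> vars_fm \<phi>" "is_data s" for s x
    using that by (auto simp: sat_fin_fm tree_structure_def)
  \<comment> \<open>\<open>w\<close> repairs infinite values at datatype variables. By
    \<open>fin\<close> such variables do not occur in the formula, so \<open>relativize\<close>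
    cannot see the change.\<close>
  define w where "w s x = (if is_data s \<and> \<not> finite_tree (v s x)
    then SOME t. t \<in> cd_universe \<Sigma> s else v s x)" for s x
  have w: "w s x \<in> cd_universe \<Sigma> s" if "s \<in> csorts \<Sigma>" for s x
    using someI_ex[OF data_universe_nonempty[OF \<Sigma> that]] v[OF that]
    by (auto simp: w_def) (auto simp: cd_universe_def)
  \<comment> \<open>The selector defaults are taken from \<open>w\<close>; for codatatypes these are
    values of \<open>v\<close>, so \<open>v\<close> itself witnesses that they are
    inhabited.\<close>
  obtain A where A: "cd_structure \<Sigma> A"
    using cd_structure_exists[OF \<Sigma>, of "\<lambda>s. w s 0"] w by blast
  have into: "assignment_into (cd_language \<Sigma>) A w"
    using w cd_structure_universe[OF A] by (simp add: assignment_into_def cd_language_def)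
  have "v s x = w s x" if "(s, x) \<in> vars_fm \<phi>" for s x
    using fin[OF that] by (auto simp: w_def)
  with sat have "sat (tree_structure \<Sigma>) w (relativize \<phi>)"
    using sat_relativize_cong[of \<phi> v w \<Sigma>] by blast
  then have "sat A w \<phi>"
    using sat_relativize[OF \<Sigma> A \<phi> into] by simp
  with A into show "cd_satisfiable \<Sigma> \<phi>"
    by (auto simp: cd_satisfiable_def satisfiable_in_def)
qed

theorem theorem4:
  shows "\<exists>T :: (cd_fun, unit) fm \<Rightarrow> (nat, sort) fm.
    effective_on {\<phi>. selector_free \<phi>} cd_fm_code tree_fm_code T \<and>
    (\<forall>\<Sigma> \<phi>. cd_signature \<Sigma> \<and> formula_over (cd_language \<Sigma>) \<phi> \<and> selector_free \<phi> \<longrightarrow>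
       formula_over (tree_language \<Sigma>) (T \<phi>) \<and>
       (cd_satisfiable \<Sigma> \<phi> \<longleftrightarrow> tree_satisfiable \<Sigma> (T \<phi>)))"
  \<comment> \<open>The witness is \<open>to_tree_fm\<close>, whose single program serves every
    signature.\<close>
  using effective_to_tree_fm formula_over_to_tree_fm cd_satisfiable_iff by blast

end
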